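(* Aldous' beta-splitting models for $\beta\in(-2,\infty]$ are the only consistent Markovian binary (exchangeable) fragmentation models whose splitting rule is of the form $$p(i,j)=\frac{w(i)\,w(j)}{Z(i+j)}\qquad\text{for all } i,j\ge 1,$$ for some sequence of weights $w(j)\ge 0$, $j\ge 1$, and normalization constants $Z(n)$, $n\ge 2$. That is, a consistent Markovian binary fragmentation model has a splitting rule of this form if and only if its splitting rule is that of Aldous' beta-splitting model for some $\beta\in(-2,\infty]$.
   Context: **Fragmentations.** For a finite non-empty set $B$, a *fragmentation of $B$* is a collection $\mathbf t_B$ of non-empty subsets of $B$ such that $B\in\mathbf t_B$ and, if $\#B\ge 2$, there is a partition $\{B_1,\dots,B_k\}$ of $B$ into $k\ge 2$ non-empty parts (the *children* of $B$) with $\mathbf t_B=\{B\}\cup\mathbf t_{B_1}\cup\cdots\cup\mathbf t_{B_k}$, where each $\mathbf t_{B_i}$ is (recursively) a fragmentation of $B_i$. It is *binary* if every $A\in\mathbf t_B$ has $0$ or $2$ children. For non-empty $A\subseteq B$, the *restriction* of $\mathbf t_B$ to $A$ is the fragmentation $\{C\cap A: C\in\mathbf t_B,\ C\cap A\ne\varnothing\}$ of $A$; for a random fragmentation $T_B$ the restriction is denoted $T_{A,B}$. **Models.** A *random fragmentation model* assigns to each finite non-empty $B\subset\mathbb N$ a probability distribution for a random fragmentation $T_B$ of $B$. All models are assumed *exchangeable*: the distribution of $T_B$ is invariant under permutations of $B$, and the distribution of the partition $\Pi_B$ of $B$ into its children in $T_B$ is $\mathbb P(\Pi_B=\{B_1,\dots,B_k\})=p(\#B_1,\dots,\#B_k)$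 for a symmetric function $p$ (the *splitting rule* ) that does not depend on $B$. The model is *consistent* if for all $A\subset B$ the restriction $T_{A,B}$ has the same distribution as $T_A$; *Markovian* if, given $\Pi_B=\{B_1,\dots,B_k\}$, the restricted trees $T_{B_1,B},\dots,T_{B_k,B}$ are independent and distributed as $T_{B_1},\dots,T_{B_k}$; *binary* if $T_B$ is binary with probability one for every $B$. In the binary Markovian case the splitting rule is a symmetric non-negative function $p(i,j)$, $i,j\ge1$, with $\sum_{k=1}^{n-1}\binom{n-1}{k-1}p(k,n-k)=1$ for all $n\ge 2$, and it determines the model. **Aldous' beta-splitting model** with parameter $\beta\in(-2,\infty]$ is the Markovian binary model with splitting rule $$p(i,j)=\frac{1}{Z_\beta(i+j)}\int_{(0,1)}x^i(1-x)^j\,\nu_\beta(\mathrm dx),\qquad i,j\ge 1,$$ where $\nu_\beta(\mathrm dx)=x^\beta(1-x)^\beta\,\mathrm dx$ for $\beta\in(-2,\infty)$, $\nu_\infty=\delta_{1/2}$, and $Z_\beta(n)$, $n\ge 2$, are the normalization constants. *)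

theory Defs
  imports "HOL-Probability.Probability"
begin

section \<open>Fragmentations of a finite set\<close>

inductive fragmentation :: "'a set \<Rightarrow> 'a set set \<Rightarrow> bool" where
  singleton: "fragmentation {b} {{b}}"
| split: "\<lbrakk>finite B; partition_on B P; 2 \<le> card P; \<And>C. C \<in> P \<Longrightarrow> fragmentation C (s C)\<rbrakk>
    \<Longrightarrow> fragmentation B (insert B (\<Union>C\<in>P. s C))"

definition splits_into :: "'a set \<Rightarrow> 'a set set \<Rightarrow> 'a set set \<Rightarrow> bool" where
  "splits_into B t P \<longleftrightarrow> partition_on B P \<and> 2 \<le> card P \<and>
     (\<exists>s. (\<forall>C\<in>P. fragmentation C (s C)) \<and> t = insert B (\<Union>C\<in>P. s C))"

text \<open>For a vertex \<open>A \<in> t\<close>, the fragmentation of \<open>A\<close> that occurs in the recursive construction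
  of \<open>t\<close> is \<open>{C \<in> t. C \<subseteq> A}\<close> (lemma \<open>fragmentation_subtree\<close>), and its partition into children
  is unique (lemmas \<open>splits_into_unique\<close>, \<open>splits_into_children\<close>). Singletons have no children.\<close>

definition children :: "'a set set \<Rightarrow> 'a set \<Rightarrow> 'a set set" where
  "children t A = (if 2 \<le> card A then THE P. splits_into A {C \<in> t. C \<subseteq> A} P else {})"

definition binary_fragmentation :: "'a set set \<Rightarrow> bool" where
  "binary_fragmentation t \<longleftrightarrow> (\<forall>A\<in>t. card (children t A) = 0 \<or> card (children t A) = 2)"

definition restriction :: "'a set \<Rightarrow> 'a set set \<Rightarrow> 'a set set" where
  "restriction A t = {C \<inter> A | C. C \<in> t \<and> C \<inter> A \<noteq> {}}"

lemma fragmentation_props: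
  assumes "fragmentation B t"
  shows "finite B" "B \<noteq> {}" "B \<in> t" "\<And>C. C \<in> t \<Longrightarrow> C \<subseteq> B" "{} \<notin> t"
  using assms
proof (induction rule: fragmentation.induct)
  case (split B P s)
  have "P \<noteq> {}" using split(3) by auto
  then have ne: "B \<noteq> {}" using split(2) by (auto simp: partition_on_def)
  { case 1 show ?case by (rule split) }
  { case 2 show ?case by (rule ne) }
  { case 3 show ?case by simp }
  { case (4 C) then show ?case using split(2) split.IH(4) unfolding partition_on_def by blast }
  { case 5 show ?case using split.IH(5) ne by blast }
qed auto

lemma partition_on_proper:
  assumes "partition_on B P" "2 \<le> card P" "C \<in> P"
  shows "C \<subset> B"
proof -
  have "P \<noteq> {C}" using assms(2) by auto
  then obtain D where D: "D \<in> P" "D \<noteq> C" using assms(3) by blast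
  then have "D \<noteq> {}" "D \<inter> C = {}" "D \<subseteq> B" "C \<subseteq> B"
    using assms(1,3) by (auto simp: partition_on_def disjoint_def)
  then show ?thesis by blast
qed

lemma splits_into_maximal:
  assumes "splits_into B t P"
  shows "P = {C \<in> t. C \<subset> B \<and> (\<forall>D\<in>t. D \<subset> B \<longrightarrow> C \<subseteq> D \<longrightarrow> D = C)}"
proof -
  obtain s where part: "partition_on B P" and P2: "2 \<le> card P"
    and s: "\<And>C. C \<in> P \<Longrightarrow> fragmentation C (s C)" and t: "t = insert B (\<Union>C\<in>P. s C)"
    using assms by (auto simp: splits_into_def)
  have ne: "\<And>C. C \<in> P \<Longrightarrow> C \<noteq> {}"
    and dis: "\<And>C D. C \<in> P \<Longrightarrow> D \<in> P \<Longrightarrow> C \<noteq> D \<Longrightarrow> C \<inter> D = {}"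
    using part by (auto simp: partition_on_def disjoint_def)
  have sub: "C \<in> t" if "C \<in> P" for C
    using fragmentation_props(3)[OF s[OF that]] that t by auto
  have below: "\<exists>C\<in>P. D \<subseteq> C" if "D \<in> t" "D \<subset> B" for D
    using that t fragmentation_props(4)[OF s] by blast
  show ?thesis
  proof (intro equalityI subsetI)
    fix C assume C: "C \<in> P"
    have "D = C" if D: "D \<in> t" "D \<subset> B" "C \<subseteq> D" for D
    proof -
      obtain E where "E \<in> P" "D \<subseteq> E" using below[OF D(1,2)] by blast
      then show ?thesis using dis[OF C, of E] ne[OF C] D(3) by blast
    qed
    then show "C \<in> {C \<in> t. C \<subset> B \<and> (\<forall>D\<in>t. D \<subset> B \<longrightarrow> C \<subseteq> D \<longrightarrow> D = C)}"
      using sub[OF C] partition_on_proper[OF part P2 C] by blast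
  next
    fix C assume "C \<in> {C \<in> t. C \<subset> B \<and> (\<forall>D\<in>t. D \<subset> B \<longrightarrow> C \<subseteq> D \<longrightarrow> D = C)}"
    then have C: "C \<in> t" "C \<subset> B" "\<And>D. D \<in> t \<Longrightarrow> D \<subset> B \<Longrightarrow> C \<subseteq> D \<Longrightarrow> D = C" by auto
    obtain E where E: "E \<in> P" "C \<subseteq> E" using below[OF C(1,2)] by blast
    then have "E = C" using C(3)[OF sub[OF E(1)] partition_on_proper[OF part P2 E(1)] E(2)] by simp
    then show "C \<in> P" using E(1) by simp
  qed
qed

lemma splits_into_unique:
  "splits_into B t P \<Longrightarrow> splits_into B t Q \<Longrightarrow> P = Q"
  using splits_into_maximal[of B t P] splits_into_maximal[of B t Q] by simp

lemma fragmentation_splits: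
  assumes "fragmentation B t" "2 \<le> card B"
  shows "\<exists>P. splits_into B t P"
  using assms by (cases rule: fragmentation.cases) (auto simp: splits_into_def)

lemma splits_into_children:
  assumes "fragmentation B t" "splits_into B t P"
  shows "children t B = P"
proof -
  have fin: "finite B" and below: "{C \<in> t. C \<subseteq> B} = t"
    using fragmentation_props[OF assms(1)] by auto
  have P: "partition_on B P" "2 \<le> card P" using assms(2) by (auto simp: splits_into_def)
  have "P \<noteq> {}" using P(2) by auto
  then obtain C where C: "C \<in> P" by blast
  have "C \<noteq> {}" using C P(1) by (auto simp: partition_on_def)
  moreover have "C \<subset> B" using partition_on_proper[OF P C] .
  ultimately have "0 < card C" "card C < card B"
    using psubset_card_mono[OF fin] finite_subset[OF _ fin, of C] by (simp_all add: card_gt_0_iff psubset_imp_subset)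
  then have "2 \<le> card B" by simp
  then show ?thesis
    unfolding children_def below using assms(2) splits_into_unique by (auto intro!: the_equality)
qed

lemma fragmentation_subtree:
  assumes "fragmentation B t" "A \<in> t"
  shows "fragmentation A {C \<in> t. C \<subseteq> A}"
  using assms
proof (induction rule: fragmentation.induct)
  case (singleton b)
  have "{C \<in> {{b}}. C \<subseteq> {b}} = {{b}}" by auto
  then show ?case using singleton fragmentation.singleton[of b] by simp
next
  case (split B P s)
  have f: "fragmentation B (insert B (\<Union>C\<in>P. s C))"
    using split.hyps by (intro fragmentation.split)
  have dis: "\<And>C D. C \<in> P \<Longrightarrow> D \<in> P \<Longrightarrow> C \<noteq> D \<Longrightarrow> C \<inter> D = {}"
    using split.hyps(2) by (auto simp: partition_on_def disjoint_def)
  show ?case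
  proof (cases "A = B")
    case True
    then have "{C \<in> insert B (\<Union>C\<in>P. s C). C \<subseteq> A} = insert B (\<Union>C\<in>P. s C)"
      using fragmentation_props(4)[OF f] by blast
    then show ?thesis using f True by simp
  next
    case False
    then obtain E where E: "E \<in> P" "A \<in> s E" using split.prems by auto
    have fE: "fragmentation E (s E)" using split.hyps(4)[OF E(1)] .
    have AE: "A \<subseteq> E" using fragmentation_props(4)[OF fE E(2)] .
    have "E \<subset> B" using partition_on_proper[OF split.hyps(2,3) E(1)] .
    moreover have "C \<in> s E" if "C \<in> s D" "D \<in> P" "C \<subseteq> A" for C D
    proof -
      have fD: "fragmentation D (s D)" using split.hyps(4)[OF that(2)] .
      have "C \<subseteq> D" "C \<noteq> {}" using fragmentation_props(4,5)[OF fD] that(1) by auto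
      then have "D = E" using dis[OF that(2) E(1)] that(3) AE by blast
      then show ?thesis using that by simp
    qed
    ultimately have "{C \<in> insert B (\<Union>C\<in>P. s C). C \<subseteq> A} = {C \<in> s E. C \<subseteq> A}"
      using E(1) AE by blast
    then show ?thesis using split.IH[OF E(1)] E(2) by simp
  qed
qed


section \<open>Random fragmentation models\<close>

text \<open>A model is a family of distributions indexed by sets of naturals; only its values at finite
  non-empty sets are constrained or used.\<close>

type_synonym model = "nat set \<Rightarrow> nat set set pmf"

definition random_fragmentation_model :: "model \<Rightarrow> bool" where
  "random_fragmentation_model T \<longleftrightarrow>
     (\<forall>B. finite B \<and> B \<noteq> {} \<longrightarrow> (\<forall>t\<in>set_pmf (T B). fragmentation B t))"

text \<open>A symmetric function of finitely many block sizes is a function of the multiset of sizes.\<close>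

definition splitting_rule :: "model \<Rightarrow> (nat multiset \<Rightarrow> real) \<Rightarrow> bool" where
  "splitting_rule T p \<longleftrightarrow>
     (\<forall>B P. finite B \<and> partition_on B P \<and> 2 \<le> card P \<longrightarrow>
        measure_pmf.prob (T B) {t. children t B = P} = p (image_mset card (mset_set P)))"

definition exchangeable :: "model \<Rightarrow> (nat multiset \<Rightarrow> real) \<Rightarrow> bool" where
  "exchangeable T p \<longleftrightarrow>
     (\<forall>B \<pi>. finite B \<and> B \<noteq> {} \<and> \<pi> permutes B \<longrightarrow> map_pmf (\<lambda>t. (`) \<pi> ` t) (T B) = T B) \<and>
     splitting_rule T p"

definition consistent :: "model \<Rightarrow> bool" where
  "consistent T \<longleftrightarrow>
     (\<forall>A B. finite B \<and> A \<noteq> {} \<and> A \<subset> B \<longrightarrow> map_pmf (restriction A) (T B) = T A)"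

definition markovian :: "model \<Rightarrow> bool" where
  "markovian T \<longleftrightarrow>
     (\<forall>B P. finite B \<and> 2 \<le> card B \<and> measure_pmf.prob (T B) {t. children t B = P} > 0 \<longrightarrow>
        (let Q = cond_pmf (T B) {t. children t B = P} in
           prob_space.indep_vars (measure_pmf Q) (\<lambda>_. count_space UNIV) restriction P \<and>
           (\<forall>C\<in>P. map_pmf (restriction C) Q = T C)))"

definition binary_model :: "model \<Rightarrow> bool" where
  "binary_model T \<longleftrightarrow>
     (\<forall>B. finite B \<and> B \<noteq> {} \<longrightarrow> (AE t in measure_pmf (T B). binary_fragmentation t))"

text \<open>In the binary case \<open>p(i,j)\<close> is \<open>p {#i, j#}\<close>; the conjunct \<open>Z n \<noteq> 0\<close> makes
  the quotients meaningful, as HOL division by zero yields zero.\<close>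

definition product_form :: "(nat multiset \<Rightarrow> real) \<Rightarrow> bool" where
  "product_form p \<longleftrightarrow>
     (\<exists>w Z :: nat \<Rightarrow> real. (\<forall>j\<ge>1. 0 \<le> w j) \<and> (\<forall>n\<ge>2. Z n \<noteq> 0) \<and>
        (\<forall>i\<ge>1. \<forall>j\<ge>1. p {#i, j#} = w i * w j / Z (i + j)))"


section \<open>Aldous' beta-splitting rule\<close>

definition beta_measure :: "ereal \<Rightarrow> real measure" where
  "beta_measure \<beta> =
     (if \<beta> = \<infinity> then return borel (1/2)
      else density lborel (\<lambda>x. ennreal (indicator {0<..<1} x *
             (x powr real_of_ereal \<beta> * (1 - x) powr real_of_ereal \<beta>))))"

definition beta_integral :: "ereal \<Rightarrow> nat \<Rightarrow> nat \<Rightarrow> real" where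
  "beta_integral \<beta> i j = (LINT x:{0<..<1}|beta_measure \<beta>. x ^ i * (1 - x) ^ j)"

text \<open>The normalization is the one forced by
  \<open>(\<Sum>k = 1..n - 1. ((n - 1) choose (k - 1)) * p(k, n - k)) = 1\<close>: the partitions of an
  \<open>n\<close>-set into two blocks are counted by the size \<open>k\<close> of the block of a fixed element.\<close>

definition beta_normalization :: "ereal \<Rightarrow> nat \<Rightarrow> real" where
  "beta_normalization \<beta> n =
     (\<Sum>k = 1..n - 1. real ((n - 1) choose (k - 1)) * beta_integral \<beta> k (n - k))"

definition beta_splitting_rule :: "ereal \<Rightarrow> nat \<Rightarrow> nat \<Rightarrow> real" where
  "beta_splitting_rule \<beta> i j = beta_integral \<beta> i j / beta_normalization \<beta> (i + j)"

definition has_beta_splitting_rule :: "(nat multiset \<Rightarrow> real) \<Rightarrow> ereal \<Rightarrow> bool" where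
  "has_beta_splitting_rule p \<beta> \<longleftrightarrow>
     (\<forall>i\<ge>1. \<forall>j\<ge>1. p {#i, j#} = beta_splitting_rule \<beta> i j)"

end

theory Submission
  imports Defs
begin

text \<open>For a binary Markovian model, consistency is equivalent to a recursion for the splitting rule:
  \<open>p(i, j) * (1 - p(i + j, 1)) = p(i + 1, j) + p(i, j + 1)\<close>. Deleting a point \<open>b\<close> from a tree on
  \<open>A \<union> {b}\<close> leaves a tree whose first split is \<open>{C, A - C}\<close> in three ways: \<open>b\<close> was on the side of \<open>C\<close> at the
  root, or on the side of \<open>A - C\<close>, or the root isolated \<open>b\<close> and the tree on \<open>A\<close> below it had this first
  split. Equating root split probabilities gives the recursion (\<open>consistent_recursion\<close>). Conversely, by the
  Markov property the law of a tree is a mixture, over the root split, of laws of pairs of independent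
  smaller trees (\<open>prob_T_mixture\<close>), so that under the recursion deletion of one point is consistent by
  induction on the size of the set (\<open>recursion_consistent\<close>).

  The beta-splitting rules satisfy the recursion, because \<open>x + (1 - x) = 1\<close> under the integral, both for
  the beta integrals themselves and, after summation, for the normalization constants. They are of product
  form because the Beta function is a quotient of Gamma functions (\<open>beta_product_form\<close>).

  Now let \<open>p(i, j) = w(i) w(j) / Z(i + j)\<close> satisfy the recursion. All weights are positive, and division
  by \<open>w(i) w(j)\<close> turns the recursion into \<open>r(i) + r(j) = c(i + j)\<close> for \<open>r(i) = w(i + 1) / w(i)\<close>. So \<open>r\<close> is
  affine with non-negative slope (\<open>weight_ratios_affine\<close>). With slope zero \<open>w\<close> is geometric and \<open>p\<close>
  depends on \<open>i + j\<close> only, which is \<open>\<beta> = \<infinity>\<close>; with positive slope \<open>w\<close> is, up to a geometric factor, a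
  sequence of Gamma values \<open>Gamma (i + \<beta> + 1)\<close>, and positivity of \<open>r(1)\<close> says \<open>\<beta> > -2\<close> (\<open>weights_beta\<close>).
  Normalization then fixes \<open>p\<close> (\<open>proportional_beta\<close>).\<close>

section \<open>Two-block partitions with a marked point\<close>

text \<open>A partition of \<open>B\<close> into two blocks is encoded by its block containing a marked point \<open>e \<in> B\<close>; the
  other block is the complement. This removes the ambiguity of ordering the two blocks.\<close>

definition blocks_with :: "'a \<Rightarrow> 'a set \<Rightarrow> 'a set set" where
  "blocks_with e B = {C. e \<in> C \<and> C \<subset> B}"

lemma finite_blocks_with: "finite B \<Longrightarrow> finite (blocks_with e B)"
  by (rule finite_subset[of _ "Pow B"]) (auto simp: blocks_with_def)

lemma blocks_withD:
  assumes "finite B" "C \<in> blocks_with e B"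
  shows "finite C" "C \<noteq> {}" "C \<subset> B" "finite (B - C)" "B - C \<noteq> {}" "C \<noteq> B - C" "e \<in> C"
    "C \<inter> (B - C) = {}" "C \<union> (B - C) = B" "2 \<le> card B" "B \<noteq> {}"
proof -
  show *: "C \<subset> B" "e \<in> C" using assms by (auto simp: blocks_with_def)
  show "finite C" "C \<noteq> {}" "finite (B - C)" "B - C \<noteq> {}" "C \<noteq> B - C" "B \<noteq> {}"
    "C \<inter> (B - C) = {}" "C \<union> (B - C) = B" using * assms(1) finite_subset by auto
  have "0 < card C" using \<open>finite C\<close> * by (auto simp: card_gt_0_iff)
  then show "2 \<le> card B" using psubset_card_mono[OF assms(1) *(1)] by simp
qed

text \<open>Deleting \<open>b\<close> from a two-block partition of \<open>A \<union> {b}\<close> leaves a two-block partition of \<open>A\<close>, from which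
  it arises in exactly two ways, unless the partition was \<open>{A, {b}}\<close>. With
  \<open>g\<close> a probability this governs the deletion of a point from a random tree, with \<open>g\<close> a beta integral it
  relates successive normalization constants.\<close>

lemma sum_blocks_with_insert:
  fixes g :: "'a set \<Rightarrow> 'b::comm_monoid_add"
  assumes "finite A" "e \<in> A" "b \<notin> A"
  shows "(\<Sum>C\<in>blocks_with e (insert b A). g C) =
           g A + (\<Sum>C\<in>blocks_with e A. g (insert b C) + g C)"
proof -
  let ?S = "blocks_with e A"
  have fin: "finite ?S" using finite_blocks_with assms(1) .
  have "blocks_with e (insert b A) = insert A (insert b ` ?S \<union> ?S)"
  proof (intro equalityI subsetI)
    fix C assume C: "C \<in> blocks_with e (insert b A)"
    show "C \<in> insert A (insert b ` ?S \<union> ?S)"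
    proof (cases "b \<in> C")
      case True
      then have "C = insert b (C - {b})" "C - {b} \<in> ?S"
        using C assms by (auto simp: blocks_with_def)
      then show ?thesis by blast
    next
      case False
      then show ?thesis using C by (auto simp: blocks_with_def)
    qed
  qed (use assms in \<open>auto simp: blocks_with_def\<close>)
  moreover have "A \<notin> insert b ` ?S \<union> ?S" "insert b ` ?S \<inter> ?S = {}"
    using assms(3) by (auto simp: blocks_with_def)
  moreover have "inj_on (insert b) ?S"
    using assms(3) by (auto simp: inj_on_def blocks_with_def)
  ultimately show ?thesis
    using fin by (simp add: sum.union_disjoint sum.reindex sum.distrib)
qed

text \<open>This converts sums over partitions into the binomial sums that define the normalization constants:
  a block of size \<open>k\<close> containing \<open>e\<close> is determined by its other \<open>k - 1\<close> points.\<close>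

lemma sum_blocks_with_card:
  fixes f :: "nat \<Rightarrow> nat \<Rightarrow> real"
  assumes "finite B" "e \<in> B"
  shows "(\<Sum>C\<in>blocks_with e B. f (card C) (card (B - C))) =
           (\<Sum>k = 1..card B - 1. real ((card B - 1) choose (k - 1)) * f k (card B - k))"
proof -
  let ?S = "blocks_with e B" and ?n = "card B"
  have fin: "finite ?S" using finite_blocks_with assms(1) .
  have card_S: "card C \<in> {1..?n - 1} \<and> card (B - C) = ?n - card C" if "C \<in> ?S" for C
  proof -
    have "C \<subset> B" "e \<in> C" using that by (auto simp: blocks_with_def)
    moreover from this have "finite C" using assms(1) finite_subset by blast
    ultimately show ?thesis using psubset_card_mono[OF assms(1), of C] card_gt_0_iff[of C]
      by (auto simp: card_Diff_subset)
  qed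
  have number: "card {C \<in> ?S. card C = k} = (?n - 1) choose (k - 1)" if k: "k \<in> {1..?n - 1}" for k
  proof -
    have "bij_betw (insert e) {D. D \<subseteq> B - {e} \<and> card D = k - 1} {C \<in> ?S. card C = k}"
    proof (rule bij_betw_byWitness[where f' = "\<lambda>C. C - {e}"])
      show "insert e ` {D. D \<subseteq> B - {e} \<and> card D = k - 1} \<subseteq> {C \<in> ?S. card C = k}"
      proof clarify
        fix D assume D: "D \<subseteq> B - {e}" "card D = k - 1"
        then have "finite D" "e \<notin> D" using assms(1) finite_subset by auto
        then have c: "card (insert e D) = k" using D k by simp
        then have "insert e D \<noteq> B" using k by auto
        then show "insert e D \<in> ?S \<and> card (insert e D) = k"
          using c D assms(2) by (auto simp: blocks_with_def)
      qed
    qed (auto simp: blocks_with_def)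
    then have "card {C \<in> ?S. card C = k} = card {D. D \<subseteq> B - {e} \<and> card D = k - 1}"
      by (simp add: bij_betw_same_card)
    then show ?thesis using n_subsets[of "B - {e}" "k - 1"] assms by simp
  qed
  have "(\<Sum>C\<in>?S. f (card C) (card (B - C))) = (\<Sum>C\<in>?S. f (card C) (?n - card C))"
    using card_S by simp
  also have "\<dots> = (\<Sum>k = 1..?n - 1. \<Sum>C\<in>{C \<in> ?S. card C = k}. f (card C) (?n - card C))"
    using card_S by (intro sum.group[symmetric] fin) auto
  also have "\<dots> = (\<Sum>k = 1..?n - 1. real ((?n - 1) choose (k - 1)) * f k (?n - k))"
    using number by (intro sum.cong) auto
  finally show ?thesis .
qed


section \<open>Joining and restricting fragmentations\<close>

lemma fragmentation_restriction_self:
  assumes "fragmentation C s" "C \<subseteq> A"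
  shows "restriction A s = s"
proof -
  have "X \<inter> A = X" "X \<noteq> {}" if "X \<in> s" for X
    using fragmentation_props(4,5)[OF assms(1)] assms(2) that by blast+
  then show ?thesis unfolding restriction_def by (auto; metis)
qed

lemma restriction_disjoint:
  assumes "fragmentation C s" "C \<inter> A = {}"
  shows "restriction A s = {}"
  using fragmentation_props(4)[OF assms(1)] assms(2) unfolding restriction_def by blast

lemma restriction_image: "restriction A t = (\<lambda>C. C \<inter> A) ` {C \<in> t. C \<inter> A \<noteq> {}}"
  unfolding restriction_def by blast

lemma restriction_restriction:
  assumes "A \<subseteq> B"
  shows "restriction A (restriction B t) = restriction A t"
proof -
  have [simp]: "C \<inter> B \<inter> A = C \<inter> A" for C using assms by blast
  have "{C \<in> restriction B t. C \<inter> A \<noteq> {}} = (\<lambda>C. C \<inter> B) ` {C \<in> t. C \<inter> A \<noteq> {}}"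
    using assms unfolding restriction_image by auto
  then show ?thesis by (simp add: restriction_image image_image)
qed

lemma restriction_Un: "restriction A (s \<union> u) = restriction A s \<union> restriction A u"
  unfolding restriction_def by blast

lemma restriction_insert: "C \<inter> A \<noteq> {} \<Longrightarrow> restriction A (insert C s) = insert (C \<inter> A) (restriction A s)"
  unfolding restriction_def by blast

lemma restriction_Int:
  assumes "fragmentation C s"
  shows "restriction A s = restriction (C \<inter> A) s"
proof -
  have "X \<inter> (C \<inter> A) = X \<inter> A" if "X \<in> s" for X
    using fragmentation_props(4)[OF assms that] by blast
  then show ?thesis unfolding restriction_image by (intro image_cong) auto
qed

lemma fragmentation_singleton:
  assumes "fragmentation {b} t"
  shows "t = {{b}}"
  using fragmentation_props(3-5)[OF assms] by (auto simp: subset_singleton_iff) 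

lemma restriction_singleton:
  assumes "fragmentation B t" "e \<in> B"
  shows "restriction {e} t = {{e}}"
  using fragmentation_props(3)[OF assms(1)] assms(2) unfolding restriction_def by auto

lemma splits_into_join:
  assumes "fragmentation C s" "fragmentation D u" "C \<inter> D = {}"
  shows "splits_into (C \<union> D) (insert (C \<union> D) (s \<union> u)) {C, D}"
    "fragmentation (C \<union> D) (insert (C \<union> D) (s \<union> u))"
proof -
  let ?v = "\<lambda>X. if X = C then s else u"
  have ne: "C \<noteq> {}" "D \<noteq> {}" using fragmentation_props(2) assms by auto
  then have CD: "C \<noteq> D" using assms(3) by auto
  then have v: "\<forall>X\<in>{C, D}. fragmentation X (?v X)" and vU: "(\<Union>X\<in>{C, D}. ?v X) = s \<union> u"
    using assms by auto
  have part: "partition_on (C \<union> D) {C, D}"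
    using ne assms(3) by (auto simp: partition_on_def disjoint_def)
  have card: "2 \<le> card {C, D}" using CD by simp
  show sp: "splits_into (C \<union> D) (insert (C \<union> D) (s \<union> u)) {C, D}"
    unfolding splits_into_def using v vU part card by metis
  have "fragmentation (C \<union> D) (insert (C \<union> D) (\<Union>X\<in>{C, D}. ?v X))"
    using v part card fragmentation_props(1) assms by (intro fragmentation.split) auto
  then show "fragmentation (C \<union> D) (insert (C \<union> D) (s \<union> u))" using vU by simp
qed

lemma children_join:
  assumes "fragmentation C s" "fragmentation D u" "C \<inter> D = {}"
  shows "children (insert (C \<union> D) (s \<union> u)) (C \<union> D) = {C, D}"
  using splits_into_children splits_into_join[OF assms] by blast

text \<open>A tree with two children at the root is recovered from its restrictions to these children, which are
  its two subtrees. Hence conditionally on the root split the law of the tree is that of the pair of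
  restrictions, which is what the Markov property describes.\<close>

lemma fragmentation_eq_join:
  assumes "fragmentation B t" "2 \<le> card B" "children t B = {C, D}" 
  shows "t = insert B (restriction C t \<union> restriction D t)"
proof -
  obtain P where P: "splits_into B t P" using fragmentation_splits[OF assms(1,2)] by blast
  then have "P = {C, D}" using splits_into_children[OF assms(1) P] assms(3) by simp
  then obtain s where part: "partition_on B {C, D}" and card: "2 \<le> card {C, D}"
    and s: "fragmentation C (s C)" "fragmentation D (s D)" and t: "t = insert B (s C \<union> s D)"
    using P by (auto simp: splits_into_def)
  have CD: "C \<noteq> D" using card by auto
  then have dis: "C \<inter> D = {}" and sub: "C \<subseteq> B" "D \<subseteq> B"
    using part by (auto simp: partition_on_def disjoint_def)
  have "restriction C t = s C"
  proof -
    have "B \<inter> C = C" "C \<noteq> {}" "C \<in> s C" using sub fragmentation_props(2,3)[OF s(1)] by auto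
    then show ?thesis using s dis unfolding t
      by (simp add: restriction_insert restriction_Un fragmentation_restriction_self 
          restriction_disjoint insert_absorb Int_commute)
  qed
  moreover have "restriction D t = s D"
  proof -
    have "B \<inter> D = D" "D \<noteq> {}" "D \<in> s D" using sub fragmentation_props(2,3)[OF s(2)] by auto
    then show ?thesis using s dis unfolding t
      by (simp add: restriction_insert restriction_Un fragmentation_restriction_self 
          restriction_disjoint insert_absorb)
  qed
  ultimately show ?thesis using t by simp
qed

lemma restriction_join:
  assumes "fragmentation C s" "fragmentation D u" "A \<subseteq> C \<union> D" "A \<noteq> {}"
  shows "restriction A (insert (C \<union> D) (s \<union> u)) =
           insert A (restriction (C \<inter> A) s \<union> restriction (D \<inter> A) u)"
proof -
  have "(C \<union> D) \<inter> A = A" using assms(3) by blast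
  then show ?thesis
    using assms(4) restriction_Int[OF assms(1), of A] restriction_Int[OF assms(2), of A]
    by (simp add: restriction_insert restriction_Un)
qed


section \<open>Beta integrals\<close>

lemma beta_integral_finite:
  assumes "-2 < r" "1 \<le> i" "1 \<le> j"
  shows "beta_integral (ereal r) i j = Beta (real i + r + 1) (real j + r + 1)"
proof -
  let ?f = "\<lambda>x::real. x powr (real i + r) * (1 - x) powr (real j + r)"
  have ab: "0 < real i + r + 1" "0 < real j + r + 1" using assms by linarith+
  have "(?f has_integral Beta (real i + r + 1) (real j + r + 1)) {0..1}"
    using has_integral_Beta_real[OF ab] by (simp add: add_diff_eq)
  then have hi: "(?f has_integral Beta (real i + r + 1) (real j + r + 1)) {0<..<1}"
    using has_integral_Icc_iff_Ioo by blast
  have nn: "(\<integral>\<^sup>+x. ennreal (indicator {0<..<1} x * ?f x) \<partial>lborel) =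
      ennreal (Beta (real i + r + 1) (real j + r + 1))"
    by (rule nn_integral_has_integral_lebesgue[OF _ hi]) simp
  have "0 \<le> Beta (real i + r + 1) (real j + r + 1)"
    using ab by (simp add: Beta_def)
  have "beta_integral (ereal r) i j = (\<integral>x. (indicator {0<..<1} x * (x powr r * (1 - x) powr r)) *\<^sub>R
      (indicator {0<..<1} x *\<^sub>R (x ^ i * (1 - x) ^ j)) \<partial>lborel)"
    unfolding beta_integral_def beta_measure_def set_lebesgue_integral_def
    by (simp, subst integral_density) auto
  also have "\<dots> = (\<integral>x. indicator {0<..<1} x * ?f x \<partial>lborel)"
    by (intro Bochner_Integration.integral_cong)
       (auto simp: indicator_def powr_add powr_realpow mult_ac)
  also have "\<dots> = enn2real (\<integral>\<^sup>+x. ennreal (indicator {0<..<1} x * ?f x) \<partial>lborel)"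
    by (rule integral_eq_nn_integral) auto
  also have "\<dots> = Beta (real i + r + 1) (real j + r + 1)"
    unfolding nn using \<open>0 \<le> Beta _ _\<close> by simp
  finally show ?thesis .
qed

lemma beta_integral_infinity: "beta_integral \<infinity> i j = (1/2) ^ (i + j)"
  unfolding beta_integral_def beta_measure_def set_lebesgue_integral_def
  by (simp, subst integral_return) (auto simp: power_add)

text \<open>For finite \<open>\<beta>\<close> the factorization is \<open>Beta a b = Gamma a * Gamma b / Gamma (a + b)\<close>, with positive
  arguments because \<open>\<beta> > -2\<close> and \<open>i, j \<ge> 1\<close>; for \<open>\<beta> = \<infinity>\<close> it is \<open>(1/2) ^ (i + j) = (1/2) ^ i * (1/2) ^ j\<close>.\<close>

lemma beta_integral_product:
  assumes "-2 < \<beta>"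
  obtains w c where "\<And>j. 1 \<le> j \<Longrightarrow> 0 < w j" "\<And>n. 2 \<le> n \<Longrightarrow> 0 < c n"
    "\<And>i j. 1 \<le> i \<Longrightarrow> 1 \<le> j \<Longrightarrow> beta_integral \<beta> i j = w i * w j / c (i + j)"
proof (cases \<beta>)
  case (real r)
  then have r: "-2 < r" using assms by simp
  show ?thesis
  proof (rule that)
    show "0 < Gamma (real j + r + 1)" if "1 \<le> j" for j
      using r that by (intro Gamma_real_pos) linarith
    show "0 < Gamma (real n + 2 * r + 2)" if "2 \<le> n" for n
      using r that by (intro Gamma_real_pos) linarith
    show "beta_integral \<beta> i j =
        Gamma (real i + r + 1) * Gamma (real j + r + 1) / Gamma (real (i + j) + 2 * r + 2)"
      if "1 \<le> i" "1 \<le> j" for i j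
      using beta_integral_finite[OF r that] real by (simp add: Beta_def algebra_simps)
  qed
next
  case PInf
  show ?thesis
    by (rule that[of "\<lambda>j. (1/2) ^ j" "\<lambda>_. 1"]) (simp_all add: PInf beta_integral_infinity power_add)
next
  case MInf
  then show ?thesis using assms by simp
qed

lemma beta_integral_pos:
  assumes "-2 < \<beta>" "1 \<le> i" "1 \<le> j"
  shows "0 < beta_integral \<beta> i j"
  using beta_integral_product[OF assms(1)] assms(2,3)
  by (metis add_mono divide_pos_pos mult_pos_pos one_add_one)

text \<open>The weight \<open>x + (1 - x) = 1\<close> splits the integrand; for finite \<open>\<beta>\<close> this is the functional equation of
  the Beta function.\<close>

lemma beta_integral_add:
  assumes "-2 < \<beta>" "1 \<le> i" "1 \<le> j"
  shows "beta_integral \<beta> (i + 1) j + beta_integral \<beta> i (j + 1) = beta_integral \<beta> i j"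
proof (cases \<beta>)
  case (real r)
  then have r: "-2 < r" using assms by simp
  have "real i + r + 1 > 0" "real j + r + 1 > 0" using r assms by linarith+
  then have "Beta (real i + r + 1 + 1) (real j + r + 1) + Beta (real i + r + 1) (real j + r + 1 + 1)
      = Beta (real i + r + 1) (real j + r + 1)"
    by (intro Beta_plus1_plus1) (auto dest: nonpos_Ints_nonpos)
  then show ?thesis
    using beta_integral_finite[OF r, of i j] beta_integral_finite[OF r, of "i + 1" j]
      beta_integral_finite[OF r, of i "j + 1"] assms real by (simp add: algebra_simps)
next
  case PInf
  then show ?thesis by (simp add: beta_integral_infinity)
next
  case MInf
  then show ?thesis using assms by simp
qed

lemma beta_normalization_pos:
  assumes "-2 < \<beta>" "2 \<le> n"
  shows "0 < beta_normalization \<beta> n"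
  unfolding beta_normalization_def
proof (rule sum_pos)
  fix k assume "k \<in> {1..n - 1}"
  then have "1 \<le> k" "1 \<le> n - k" "k - 1 \<le> n - 1" using assms(2) by auto
  then show "0 < real ((n - 1) choose (k - 1)) * beta_integral \<beta> k (n - k)"
    using beta_integral_pos[OF assms(1), of k "n - k"] by (simp add: zero_less_binomial)
qed (use assms in auto)

text \<open>Summing the identity \<open>I(i+1, j) + I(i, j+1) = I(i, j)\<close> for beta integrals over all splits of an \<open>n\<close>-set
  gives all splits of an \<open>(n+1)\<close>-set except the one that isolates the new point.\<close>

lemma beta_normalization_Suc:
  assumes "-2 < \<beta>" "1 \<le> n"
  shows "beta_normalization \<beta> (n + 1) = beta_integral \<beta> n 1 + beta_normalization \<beta> n"
proof -
  let ?A = "{..<n}" and ?I = "beta_integral \<beta>"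
  have norm: "beta_normalization \<beta> (card B) = (\<Sum>C\<in>blocks_with 0 B. ?I (card C) (card (B - C)))"
    if "finite B" "0 \<in> B" for B :: "nat set"
    unfolding beta_normalization_def using sum_blocks_with_card[OF that] by simp
  have "beta_normalization \<beta> (n + 1) =
      (\<Sum>C\<in>blocks_with 0 (insert n ?A). ?I (card C) (card (insert n ?A - C)))"
    using norm[of "insert n ?A"] assms(2) by simp
  also have "\<dots> = ?I (card ?A) (card (insert n ?A - ?A)) +
      (\<Sum>C\<in>blocks_with 0 ?A. ?I (card (insert n C)) (card (insert n ?A - insert n C)) +
        ?I (card C) (card (insert n ?A - C)))"
    using assms(2) by (intro sum_blocks_with_insert) auto
  also have "(\<Sum>C\<in>blocks_with 0 ?A. ?I (card (insert n C)) (card (insert n ?A - insert n C)) +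
        ?I (card C) (card (insert n ?A - C))) = (\<Sum>C\<in>blocks_with 0 ?A. ?I (card C) (card (?A - C)))"
  proof (rule sum.cong[OF refl])
    fix C assume "C \<in> blocks_with 0 ?A"
    note C = blocks_withD[OF finite_lessThan this]
    have n: "n \<notin> C" "insert n ?A - insert n C = ?A - C" "insert n ?A - C = insert n (?A - C)"
      using C(3) by auto
    have "1 \<le> card C" "1 \<le> card (?A - C)" using C by (simp_all add: Suc_le_eq card_gt_0_iff)
    then show "?I (card (insert n C)) (card (insert n ?A - insert n C)) +
        ?I (card C) (card (insert n ?A - C)) = ?I (card C) (card (?A - C))"
      using beta_integral_add[OF assms(1), of "card C" "card (?A - C)"] C(1,4) unfolding n(2,3)
      by (simp add: n(1))
  qed
  also have "\<dots> = beta_normalization \<beta> n"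
    using norm[of ?A] assms(2) by simp
  also have "insert n ?A - ?A = {n}" by auto
  finally show ?thesis by simp
qed

lemma beta_splitting_rule_recursion:
  fixes \<beta> :: ereal
  defines "q \<equiv> beta_splitting_rule \<beta>"
  assumes "-2 < \<beta>" "1 \<le> i" "1 \<le> j"
  shows "q i j * (1 - q (i + j) 1) = q (i + 1) j + q i (j + 1)"
proof -
  let ?I = "beta_integral \<beta>" and ?N = "beta_normalization \<beta>"
  have N: "?N (i + j) \<noteq> 0" "?N (i + j + 1) \<noteq> 0"
    using beta_normalization_pos[OF assms(2), of "i + j"] beta_normalization_pos[OF assms(2), of "i + j + 1"]
      assms(3,4) by simp_all
  have "1 - q (i + j) 1 = ?N (i + j) / ?N (i + j + 1)"
    using N beta_normalization_Suc[OF assms(2), of "i + j"] assms(3)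
    by (simp add: q_def beta_splitting_rule_def field_simps)
  then have "q i j * (1 - q (i + j) 1) = ?I i j / ?N (i + j + 1)"
    using N by (simp add: q_def beta_splitting_rule_def)
  then show ?thesis
    using beta_integral_add[OF assms(2-4)]
    by (simp add: q_def beta_splitting_rule_def add_divide_distrib[symmetric] ac_simps)
qed


section \<open>Product weights that satisfy the recursion\<close>

text \<open>If \<open>w(j)\<close> vanished, the recursion for \<open>q(1, k)\<close> would annihilate all later weights, and then every split
  of \<open>2 * j\<close> points would have probability zero, because one of its blocks has at least \<open>j\<close> points.\<close>

lemma weights_pos:
  fixes w Z :: "nat \<Rightarrow> real" and q :: "nat \<Rightarrow> nat \<Rightarrow> real"
  assumes w: "\<And>j. 1 \<le> j \<Longrightarrow> 0 \<le> w j" and Z: "\<And>n. 2 \<le> n \<Longrightarrow> Z n \<noteq> 0"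
    and q: "\<And>i j. 1 \<le> i \<Longrightarrow> 1 \<le> j \<Longrightarrow> q i j = w i * w j / Z (i + j)"
    and rec: "\<And>i j. 1 \<le> i \<Longrightarrow> 1 \<le> j \<Longrightarrow>
      q i j * (1 - q (i + j) 1) = q (i + 1) j + q i (j + 1)"
    and nz: "\<And>n. 2 \<le> n \<Longrightarrow> \<exists>k\<in>{1..n - 1}. q k (n - k) \<noteq> 0"
    and j: "1 \<le> j"
  shows "0 < w j"
proof (rule ccontr)
  assume "\<not> 0 < w j"
  then have wj: "w j = 0" using w[OF j] by simp
  have w1: "w 1 \<noteq> 0" using nz[of 2] q[of 1 1] by (auto simp: numeral_2_eq_2)
  have zero: "w k = 0" if "j \<le> k" for k
    using that
  proof (induction rule: dec_induct)
    case base
    show ?case by (rule wj)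
  next
    case (step k)
    then have "w 1 * w (k + 1) / Z (k + 2) = 0"
      using rec[of 1 k] q[of 1 k] q[of 2 k] q[of 1 "k + 1"] j by (simp add: numeral_2_eq_2)
    then show ?case using w1 Z[of "k + 2"] by simp
  qed
  obtain k where k: "k \<in> {1..2 * j - 1}" "q k (2 * j - k) \<noteq> 0" using nz[of "2 * j"] j by auto
  then have "w k \<noteq> 0" "w (2 * j - k) \<noteq> 0" using q[of k "2 * j - k"] by auto
  moreover have "j \<le> k \<or> j \<le> 2 * j - k" by linarith
  ultimately show False using zero by blast
qed

text \<open>Dividing the recursion by \<open>w(i) w(j)\<close> shows that the ratios \<open>r(i) = w(i+1) / w(i)\<close> satisfy
  \<open>r(i) + r(j) = c(i + j)\<close>. Comparing \<open>(i+1, 1)\<close> with \<open>(i, 2)\<close>, the increments of \<open>r\<close> are constant; they are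
  non-negative because \<open>r\<close> stays positive.\<close>

lemma weight_ratios_affine:
  fixes w Z :: "nat \<Rightarrow> real" and q :: "nat \<Rightarrow> nat \<Rightarrow> real"
  assumes pos: "\<And>j. 1 \<le> j \<Longrightarrow> 0 < w j" and Z: "\<And>n. 2 \<le> n \<Longrightarrow> Z n \<noteq> 0"
    and q: "\<And>i j. 1 \<le> i \<Longrightarrow> 1 \<le> j \<Longrightarrow> q i j = w i * w j / Z (i + j)"
    and rec: "\<And>i j. 1 \<le> i \<Longrightarrow> 1 \<le> j \<Longrightarrow>
      q i j * (1 - q (i + j) 1) = q (i + 1) j + q i (j + 1)"
  obtains a d where "0 < a" "0 \<le> d" "\<And>i. w (i + 2) = w (i + 1) * (a + d * real i)"
proof -
  define r where "r i = w (i + 1) / w i" for i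
  define c where "c n = (Z (n + 1) - w n * w 1) / Z n" for n
  have rc: "r i + r j = c (i + j)" if ij: "1 \<le> i" "1 \<le> j" for i j
  proof -
    have nz: "w i \<noteq> 0" "w j \<noteq> 0" "Z (i + j) \<noteq> 0" "Z (i + j + 1) \<noteq> 0"
      using pos[OF ij(1)] pos[OF ij(2)] Z ij by auto
    have "w i * w j / Z (i + j) * (1 - w (i + j) * w 1 / Z (i + j + 1)) =
        w (i + 1) * w j / Z (i + j + 1) + w i * w (j + 1) / Z (i + j + 1)"
      using rec[OF ij] q ij by (simp add: ac_simps)
    then have "w i * w j * (Z (i + j + 1) - w (i + j) * w 1) =
        (w (i + 1) * w j + w i * w (j + 1)) * Z (i + j)"
      using nz by (simp add: field_simps)
    then show ?thesis using nz unfolding r_def c_def by (simp add: field_simps)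
  qed
  define d where "d = r 2 - r 1"
  have step: "r (i + 1) = r i + d" if "1 \<le> i" for i
    using rc[of "i + 1" 1] rc[of i 2] that by (simp add: d_def)
  have r: "r (i + 1) = r 1 + d * real i" for i
  proof (induction i)
    case (Suc i)
    then show ?case using step[of "i + 1"] by (simp add: algebra_simps)
  qed simp
  have rpos: "0 < r i" if "1 \<le> i" for i using pos that by (simp add: r_def)
  have "0 \<le> d"
  proof (rule ccontr)
    assume "\<not> 0 \<le> d"
    then obtain i where "r 1 < real i * (- d)" using reals_Archimedean3[of "- d"] by auto
    then show False using r[of i] rpos[of "i + 1"] by (simp add: mult.commute)
  qed
  moreover have "w (i + 2) = w (i + 1) * (r 1 + d * real i)" for i
    using r[of i] pos[of "i + 1"] by (simp add: r_def field_simps)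
  ultimately show ?thesis using that rpos[of 1] by simp
qed

text \<open>Affine ratios \<open>a + d * i\<close> with \<open>d > 0\<close> make \<open>w(i)\<close> a multiple of \<open>d ^ i * Gamma (i + r + 1)\<close> with
  \<open>r = a / d - 2\<close>, so that \<open>a > 0\<close> is the condition \<open>r > -2\<close>; constant ratios make \<open>w\<close> geometric, which is
  the case \<open>\<beta> = \<infinity>\<close>.\<close>

lemma weights_beta:
  fixes w :: "nat \<Rightarrow> real"
  assumes ad: "0 < a" "0 \<le> d"
    and w: "\<And>i. w (i + 2) = w (i + 1) * (a + d * real i)"
  obtains \<beta> c where "-2 < \<beta>"
    "\<And>i j. 1 \<le> i \<Longrightarrow> 1 \<le> j \<Longrightarrow> w i * w j = c (i + j) * beta_integral \<beta> i j"
proof (cases "d = 0")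
  case True
  have geom: "w (i + 1) = w 1 * a ^ i" for i
  proof (induction i)
    case (Suc i)
    then show ?case using w[of i] True by simp
  qed simp
  have "w i * w j = (w 1)\<^sup>2 * a ^ (i + j - 2) * 2 ^ (i + j) * beta_integral \<infinity> i j"
    if ij: "1 \<le> i" "1 \<le> j" for i j
  proof -
    obtain i' j' where "i = i' + 1" "j = j' + 1" using ij by (cases i; cases j) auto
    then show ?thesis using geom[of i'] geom[of j']
      by (simp add: beta_integral_infinity power_add power2_eq_square power_one_over)
  qed
  then show ?thesis
    by (intro that[of \<infinity> "\<lambda>n. (w 1)\<^sup>2 * a ^ (n - 2) * 2 ^ n"]) auto
next
  case False
  then have d: "0 < d" using ad by simp
  define r where "r = a / d - 2"
  define K where "K = w 1 / Gamma (r + 2)"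
  have r2: "0 < r + 2" using ad d by (simp add: r_def)
  have gam: "w (i + 1) = K * d ^ i * Gamma (real i + r + 2)" for i
  proof (induction i)
    case 0
    show ?case using Gamma_real_pos[OF r2] by (simp add: K_def)
  next
    case (Suc i)
    have "real i + r + 2 \<noteq> 0" using r2 by linarith
    then have "Gamma (real i + r + 2 + 1) = (real i + r + 2) * Gamma (real i + r + 2)"
      using r2 by (intro Gamma_plus1) (auto dest: nonpos_Ints_nonpos)
    moreover have "a + d * real i = d * (real i + r + 2)"
      using d by (simp add: r_def field_simps)
    ultimately show ?case using w[of i] Suc by (simp add: algebra_simps)
  qed
  have "w i * w j = K\<^sup>2 * d ^ (i + j - 2) * Gamma (real (i + j) + 2 * r + 2) *
      beta_integral (ereal r) i j" if ij: "1 \<le> i" "1 \<le> j" for i j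
  proof -
    obtain i' j' where i': "i = i' + 1" "j = j' + 1" using ij by (cases i; cases j) auto
    have "Gamma (real i' + (real j' + (4 + r * 2))) \<noteq> 0"
      using r2 by (intro Gamma_real_pos[THEN less_imp_neq, symmetric]) linarith
    then show ?thesis using gam[of i'] gam[of j'] beta_integral_finite[of r i j] ij r2 i'
      by (simp add: Beta_def power_add power2_eq_square algebra_simps)
  qed
  then show ?thesis using r2
    by (intro that[of "ereal r" "\<lambda>n. K\<^sup>2 * d ^ (n - 2) * Gamma (real n + 2 * r + 2)"]) auto
qed


section \<open>Markovian binary models\<close>

locale markov_binary_model =
  fixes T :: model and p :: "nat multiset \<Rightarrow> real"
  assumes model: "random_fragmentation_model T" and rule: "splitting_rule T p"
    and markov: "markovian T" and binary: "binary_model T"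
begin

text \<open>The law of the tree on \<open>B\<close> that is grown from independent trees on \<open>C\<close> and \<open>B - C\<close>, its root children.\<close>

definition joined :: "nat set \<Rightarrow> nat set \<Rightarrow> nat set set pmf" where
  "joined B C = map_pmf (\<lambda>(s, u). insert B (s \<union> u)) (pair_pmf (T C) (T (B - C)))"

lemma fragmentation_T: "finite B \<Longrightarrow> B \<noteq> {} \<Longrightarrow> t \<in> set_pmf (T B) \<Longrightarrow> fragmentation B t"
  using model by (auto simp: random_fragmentation_model_def)

lemma root_split:
  assumes "finite B" "2 \<le> card B" "e \<in> B" "t \<in> set_pmf (T B)"
  obtains C where "C \<in> blocks_with e B" "children t B = {C, B - C}"
proof -
  have f: "fragmentation B t" using fragmentation_T assms by auto
  obtain P where P: "splits_into B t P" using fragmentation_splits[OF f assms(2)] by blast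
  have ch: "children t B = P" using splits_into_children[OF f P] .
  have "binary_fragmentation t"
    using binary assms by (auto simp: binary_model_def AE_measure_pmf_iff)
  then have "card P = 2"
    using P ch fragmentation_props(3)[OF f] by (auto simp: binary_fragmentation_def splits_into_def)
  then obtain X Y where XY: "P = {X, Y}" "X \<noteq> Y" by (auto simp: card_2_iff)
  have "partition_on B {X, Y}" using P XY by (simp add: splits_into_def)
  then have 1: "X \<union> Y = B" "X \<inter> Y = {}" "X \<noteq> {}" "Y \<noteq> {}"
    using XY(2) by (auto simp: partition_on_def disjoint_def)
  then have "Y = B - X" "X = B - Y" by auto
  show ?thesis
  proof (cases "e \<in> X")
    case True
    then have "X \<in> blocks_with e B" using 1 by (auto simp: blocks_with_def)
    then show ?thesis using that ch XY \<open>Y = B - X\<close> by blast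
  next
    case False
    then have "Y \<in> blocks_with e B" using 1 assms(3) by (auto simp: blocks_with_def)
    moreover have "P = {Y, B - Y}" using XY \<open>X = B - Y\<close> by blast
    ultimately show ?thesis using that ch by blast
  qed
qed

lemma prob_root_split:
  assumes "finite B" "C \<in> blocks_with e B"
  shows "measure_pmf.prob (T B) {t. children t B = {C, B - C}} = p {#card C, card (B - C)#}"
proof -
  note C = blocks_withD[OF assms]
  have "partition_on B {C, B - C}" using C by (auto simp: partition_on_def disjoint_def)
  moreover have "2 \<le> card {C, B - C}" using C by simp
  ultimately have "measure_pmf.prob (T B) {t. children t B = {C, B - C}} =
      p (image_mset card (mset_set {C, B - C}))"
    using rule assms(1) unfolding splitting_rule_def by blast
  then show ?thesis using C by simp
qed

text \<open>This is the Markov property in the form used here: given the root split \<open>{C, B - C}\<close>, the law of the tree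
  is \<open>joined B C\<close>.\<close>

lemma prob_root_split_inter:
  assumes "finite B" "C \<in> blocks_with e B"
  shows "measure_pmf.prob (T B) ({t. children t B = {C, B - C}} \<inter> X) =
           p {#card C, card (B - C)#} * measure_pmf.prob (joined B C) X"
proof -
  note C = blocks_withD[OF assms]
  let ?E = "{t. children t B = {C, B - C}}"
  show ?thesis
  proof (cases "measure_pmf.prob (T B) ?E = 0")
    case True
    then have "measure_pmf.prob (T B) (?E \<inter> X) = 0"
      unfolding measure_pmf_zero_iff by blast
    then show ?thesis using True prob_root_split[OF assms] by simp
  next
    case False
    then have pos: "0 < measure_pmf.prob (T B) ?E"
      using measure_nonneg[of "measure_pmf (T B)" ?E] by linarith
    define Q where "Q = cond_pmf (T B) ?E"
    have ne: "set_pmf (T B) \<inter> ?E \<noteq> {}"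
      using False measure_pmf_zero_iff[of "T B" ?E] by blast
    have ind: "prob_space.indep_vars (measure_pmf Q) (\<lambda>_. count_space UNIV) restriction {C, B - C}"
      and marg: "map_pmf (restriction C) Q = T C" "map_pmf (restriction (B - C)) Q = T (B - C)"
      using markov assms(1) C(10) pos unfolding markovian_def Q_def by (auto simp: Let_def)
    \<comment> \<open>Independence of the two restrictions, checked on singletons, identifies their joint law.\<close>
    have pair: "map_pmf (\<lambda>t. (restriction C t, restriction (B - C) t)) Q = pair_pmf (T C) (T (B - C))"
    proof (rule pmf_eqI, clarify)
      fix s u :: "nat set set"
      let ?A = "\<lambda>D. if D = C then {s} else {u}"
      have "measure_pmf.prob Q (\<Inter>D\<in>{C, B - C}. restriction D -` ?A D \<inter> space (measure_pmf Q)) =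
          (\<Prod>D\<in>{C, B - C}. measure_pmf.prob Q (restriction D -` ?A D \<inter> space (measure_pmf Q)))"
        by (rule prob_space.indep_varsD[OF prob_space_measure_pmf ind]) auto
      also have "\<dots> = measure_pmf.prob Q (restriction C -` {s}) * 
          measure_pmf.prob Q (restriction (B - C) -` {u})"
        using C(6) by simp
      also have "\<dots> = pmf (T C) s * pmf (T (B - C)) u"
        unfolding marg[symmetric] by (simp add: pmf_map)
      also have "(\<Inter>D\<in>{C, B - C}. restriction D -` ?A D \<inter> space (measure_pmf Q)) =
          (\<lambda>t. (restriction C t, restriction (B - C) t)) -` {(s, u)}"
        using C(6) by auto
      finally show "pmf (map_pmf (\<lambda>t. (restriction C t, restriction (B - C) t)) Q) (s, u) =
          pmf (pair_pmf (T C) (T (B - C))) (s, u)"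
        by (simp add: pmf_map pmf_pair)
    qed
    have "Q = map_pmf (\<lambda>t. insert B (restriction C t \<union> restriction (B - C) t)) Q"
    proof (rule map_pmf_idI[symmetric])
      fix t assume "t \<in> set_pmf Q"
      then have t: "t \<in> set_pmf (T B)" "children t B = {C, B - C}" using ne by (auto simp: Q_def)
      then show "insert B (restriction C t \<union> restriction (B - C) t) = t"
        using fragmentation_eq_join[OF fragmentation_T C(10), of t] assms(1) C(11) by simp
    qed
    also have "\<dots> = joined B C"
      unfolding joined_def pair[symmetric] by (simp add: map_pmf_comp)
    finally have Q: "Q = joined B C" .
    have "emeasure (measure_pmf Q) X = emeasure (measure_pmf (T B)) (?E \<inter> X) / emeasure (measure_pmf (T B)) ?E"
      unfolding Q_def cond_pmf.rep_eq[OF ne] by (rule emeasure_uniform_measure) auto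
    then have "measure_pmf.prob Q X = measure_pmf.prob (T B) (?E \<inter> X) / measure_pmf.prob (T B) ?E"
      using pos by (simp add: measure_pmf.emeasure_eq_measure divide_ennreal)
    then show ?thesis using pos Q prob_root_split[OF assms] by (simp add: field_simps)
  qed
qed

lemma prob_T_mixture:
  assumes "finite B" "2 \<le> card B" "e \<in> B"
  shows "measure_pmf.prob (T B) X =
           (\<Sum>C\<in>blocks_with e B. p {#card C, card (B - C)#} * measure_pmf.prob (joined B C) X)"
proof -
  let ?E = "\<lambda>C. {t. children t B = {C, B - C}}"
  have "measure_pmf.prob (T B) X = measure_pmf.prob (T B) (\<Union>C\<in>blocks_with e B. ?E C \<inter> X)"
  proof (rule measure_pmf.finite_measure_eq_AE)
    show "AE t in measure_pmf (T B). (t \<in> X) = (t \<in> (\<Union>C\<in>blocks_with e B. ?E C \<inter> X))"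
      unfolding AE_measure_pmf_iff
    proof
      fix t assume "t \<in> set_pmf (T B)"
      then obtain C where "C \<in> blocks_with e B" "children t B = {C, B - C}"
        by (rule root_split[OF assms])
      then show "(t \<in> X) = (t \<in> (\<Union>C\<in>blocks_with e B. ?E C \<inter> X))" by auto
    qed
  qed auto
  also have "\<dots> = (\<Sum>C\<in>blocks_with e B. measure_pmf.prob (T B) (?E C \<inter> X))"
  proof (rule measure_pmf.finite_measure_finite_Union)
    show "disjoint_family_on (\<lambda>C. ?E C \<inter> X) (blocks_with e B)"
      by (auto simp: disjoint_family_on_def blocks_with_def doubleton_eq_iff)
  qed (use finite_blocks_with assms(1) in auto)
  also have "\<dots> = (\<Sum>C\<in>blocks_with e B. p {#card C, card (B - C)#} * measure_pmf.prob (joined B C) X)"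
    using prob_root_split_inter assms(1) by (intro sum.cong) auto
  finally show ?thesis .
qed

text \<open>The total mass of the root split distribution, as a condition on the splitting rule.\<close>

lemma splitting_rule_sum:
  assumes "2 \<le> n"
  shows "(\<Sum>k = 1..n - 1. real ((n - 1) choose (k - 1)) * p {#k, n - k#}) = 1"
proof -
  have "1 = (\<Sum>C\<in>blocks_with 0 {..<n}. p {#card C, card ({..<n} - C)#})"
    using prob_T_mixture[of "{..<n}" 0 UNIV] assms by simp
  also have "\<dots> = (\<Sum>k = 1..card {..<n} - 1.
      real ((card {..<n} - 1) choose (k - 1)) * p {#k, card {..<n} - k#})"
    using assms by (intro sum_blocks_with_card) auto
  finally show ?thesis by simp
qed

lemma prob_joined_children:
  assumes "finite B" "C \<in> blocks_with e B" "D \<in> blocks_with e B"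
  shows "measure_pmf.prob (joined B C) {t. children t B = {D, B - D}} = (if C = D then 1 else 0)"
proof -
  note C = blocks_withD[OF assms(1,2)]
  have ch: "children t B = {C, B - C}" if "t \<in> set_pmf (joined B C)" for t
  proof -
    obtain s u where "s \<in> set_pmf (T C)" "u \<in> set_pmf (T (B - C))" "t = insert B (s \<union> u)"
      using \<open>t \<in> set_pmf (joined B C)\<close> by (auto simp: joined_def)
    then show ?thesis
      using children_join[of C s "B - C" u] C(1-5,8,9) fragmentation_T by simp
  qed
  have eq: "{C, B - C} = {D, B - D} \<longleftrightarrow> C = D"
    using assms by (auto simp: doubleton_eq_iff blocks_with_def)
  show ?thesis
  proof (cases "C = D")
    case True
    then have "measure_pmf.prob (joined B C) {t. children t B = {D, B - D}} = 1"
      using ch by (subst measure_pmf.prob_eq_1) (auto simp: AE_measure_pmf_iff)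
    then show ?thesis using True by simp
  next
    case False
    then show ?thesis using ch eq by (simp add: measure_pmf_zero_iff disjoint_iff)
  qed
qed

lemma restriction_joined:
  assumes "finite B" "C \<in> blocks_with e B" "A \<subseteq> B" "A \<noteq> {}"
  shows "map_pmf (restriction A) (joined B C) =
    map_pmf (\<lambda>(s, u). insert A (s \<union> u))
      (pair_pmf (map_pmf (restriction (C \<inter> A)) (T C)) (map_pmf (restriction (A - C)) (T (B - C))))"
proof -
  note C = blocks_withD[OF assms(1,2)]
  have rest: "(B - C) \<inter> A = A - C" using assms(3) by blast
  have "map_pmf (restriction A) (joined B C) =
      map_pmf (\<lambda>(s, u). restriction A (insert B (s \<union> u))) (pair_pmf (T C) (T (B - C)))"
    by (simp add: joined_def map_pmf_comp case_prod_unfold)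
  also have "\<dots> = map_pmf (\<lambda>(s, u). insert A (restriction (C \<inter> A) s \<union> restriction (A - C) u))
      (pair_pmf (T C) (T (B - C)))"
  proof (rule map_pmf_cong[OF refl], clarify)
    fix s u assume "(s, u) \<in> set_pmf (pair_pmf (T C) (T (B - C)))"
    then have "fragmentation C s" "fragmentation (B - C) u" using fragmentation_T C by auto
    from restriction_join[OF this, of A]
    show "restriction A (insert B (s \<union> u)) = insert A (restriction (C \<inter> A) s \<union> restriction (A - C) u)"
      using C(9) assms(3,4) rest by simp
  qed
  also have "\<dots> = map_pmf (\<lambda>(s, u). insert A (s \<union> u))
      (pair_pmf (map_pmf (restriction (C \<inter> A)) (T C)) (map_pmf (restriction (A - C)) (T (B - C))))"
    by (simp add: pair_map_pmf1 pair_map_pmf2 map_pmf_comp case_prod_unfold)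
  finally show ?thesis .
qed

lemma restriction_self_T:
  assumes "finite B" "B \<noteq> {}"
  shows "map_pmf (restriction B) (T B) = T B"
proof (rule map_pmf_idI)
  fix t assume "t \<in> set_pmf (T B)"
  from fragmentation_restriction_self[OF fragmentation_T[OF assms this] order_refl]
  show "restriction B t = t" .
qed

lemma T_singleton: "T {b} = return_pmf {{b}}"
proof -
  have "t = {{b}}" if "t \<in> set_pmf (T {b})" for t
    using fragmentation_singleton fragmentation_T[of "{b}" t] that by simp
  then show ?thesis by (intro set_pmf_subset_singleton[THEN iffD1]) blast
qed

lemma restriction_T_singleton:
  assumes "finite B" "b \<in> B"
  shows "map_pmf (restriction {b}) (T B) = T {b}"
proof -
  have "map_pmf (restriction {b}) (T B) = map_pmf (\<lambda>_. {{b}}) (T B)"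
  proof (rule map_pmf_cong[OF refl])
    fix t assume "t \<in> set_pmf (T B)"
    then have "fragmentation B t" using fragmentation_T assms by blast
    then show "restriction {b} t = {{b}}" using assms(2) by (rule restriction_singleton)
  qed
  then show ?thesis by (simp add: T_singleton map_pmf_const)
qed

text \<open>The effect of deleting a single point \<open>b\<close>, provided that deleting it from smaller trees is already known
  to be consistent. If \<open>b\<close> is alone at the first split, the tree on \<open>A\<close> remains. Otherwise the first split
  of \<open>A\<close> is that of \<open>A \<union> {b}\<close> without \<open>b\<close>, and the two subtrees have the right laws by assumption. This
  formula serves both directions: it yields the recursion for a consistent model, and it is the induction
  step when consistency is derived from the recursion.\<close>

lemma prob_restriction_remove_point:
  assumes A: "finite A" "2 \<le> card A" "e \<in> A" "b \<notin> A"
    and IH: "\<And>C. C \<noteq> {} \<Longrightarrow> C \<subset> A \<Longrightarrow> map_pmf (restriction C) (T (insert b C)) = T C"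
  shows "measure_pmf.prob (map_pmf (restriction A) (T (insert b A))) X =
    p {#card A, 1#} * measure_pmf.prob (T A) X +
    (\<Sum>C\<in>blocks_with e A. (p {#card C + 1, card (A - C)#} + p {#card C, card (A - C) + 1#}) *
      measure_pmf.prob (joined A C) X)"
proof -
  let ?B = "insert b A"
  let ?g = "\<lambda>C. p {#card C, card (?B - C)#} * measure_pmf.prob (map_pmf (restriction A) (joined ?B C)) X"
  have B: "finite ?B" "2 \<le> card ?B" "e \<in> ?B" "A \<subseteq> ?B" "A \<noteq> {}" using A by auto
  have "measure_pmf.prob (map_pmf (restriction A) (T ?B)) X = (\<Sum>C\<in>blocks_with e ?B. ?g C)"
    using prob_T_mixture[OF B(1-3), of "restriction A -` X"] by simp
  also have "\<dots> = ?g A + (\<Sum>C\<in>blocks_with e A. ?g (insert b C) + ?g C)"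
    by (rule sum_blocks_with_insert[OF A(1,3,4)])
  also have "?g A = p {#card A, 1#} * measure_pmf.prob (T A) X"
  proof -
    have AB: "A \<in> blocks_with e ?B" using A by (auto simp: blocks_with_def)
    have B_A: "?B - A = {b}" using A by auto
    have "map_pmf (restriction A) (joined ?B A) =
        map_pmf (\<lambda>(s, u). insert A (s \<union> u)) (pair_pmf (T A) (return_pmf {}))"
      using restriction_joined[OF B(1) AB B(4,5)] restriction_self_T[OF A(1) B(5)]
      by (simp add: B_A T_singleton restriction_def)
    also have "\<dots> = map_pmf (\<lambda>s. insert A s) (T A)"
      by (simp add: pair_pmf_def map_bind_pmf bind_return_pmf bind_assoc_pmf map_pmf_def)
    also have "\<dots> = T A"
      using fragmentation_props(3)[OF fragmentation_T[OF A(1) B(5)]]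
      by (intro map_pmf_idI) (auto simp: insert_absorb)
    finally show ?thesis using B_A by simp
  qed
  also have "(\<Sum>C\<in>blocks_with e A. ?g (insert b C) + ?g C) =
    (\<Sum>C\<in>blocks_with e A. (p {#card C + 1, card (A - C)#} + p {#card C, card (A - C) + 1#}) *
      measure_pmf.prob (joined A C) X)"
  proof (rule sum.cong[OF refl])
    fix C assume "C \<in> blocks_with e A"
    note C = blocks_withD[OF A(1) this] and C' = this
    have b: "b \<notin> C" using C A by auto
    have in1: "insert b C \<in> blocks_with e ?B" and in2: "C \<in> blocks_with e ?B"
      using C' b A by (auto simp: blocks_with_def)
    have d1: "?B - insert b C = A - C" and d2: "?B - C = insert b (A - C)" and d3: "insert b C \<inter> A = C"
      and d4: "A - insert b C = A - C" and d5: "C \<inter> A = C"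
      using b A C by auto
    have "map_pmf (restriction A) (joined ?B (insert b C)) = joined A C"
      using restriction_joined[OF B(1) in1 B(4,5)] IH[OF C(2,3)] restriction_self_T[OF C(4,5)]
      by (simp add: d1 d3 d4 joined_def[of A C])
    moreover have "map_pmf (restriction A) (joined ?B C) = joined A C"
    proof -
      have "A - C \<subset> A" using C by auto
      then show ?thesis
        using restriction_joined[OF B(1) in2 B(4,5)] IH[OF C(5)] restriction_self_T[OF C(1,2)]
        by (simp add: d2 d5 joined_def[of A C])
    qed
    ultimately show "?g (insert b C) + ?g C =
      (p {#card C + 1, card (A - C)#} + p {#card C, card (A - C) + 1#}) * measure_pmf.prob (joined A C) X"
      using C(1,4) b A d1 d2 by (simp add: algebra_simps)
  qed
  finally show ?thesis .
qed

text \<open>Compare the probabilities of a fixed root split \<open>{D, A - D}\<close> with \<open>#D = i\<close> and \<open>#(A - D) = j\<close> on both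
  sides of \<open>prob_restriction_remove_point\<close>: each law \<open>joined A C\<close> charges only the root split \<open>{C, A - C}\<close>,
  so a single summand survives.\<close>

lemma consistent_recursion:
  assumes "consistent T" "1 \<le> i" "1 \<le> j"
  shows "p {#i, j#} * (1 - p {#i + j, 1#}) = p {#i + 1, j#} + p {#i, j + 1#}"
proof -
  let ?A = "{..<i + j}" and ?D = "{..<i}"
  let ?X = "{t. children t ?A = {?D, ?A - ?D}}"
  have D: "?D \<in> blocks_with 0 ?A" using assms(2,3) by (auto simp: blocks_with_def)
  have cards: "card (?A - ?D) = j" by (simp add: card_Diff_subset)
  have cons: "map_pmf (restriction C) (T (insert (i + j) C)) = T C" if "C \<noteq> {}" "C \<subseteq> ?A" for C
  proof -
    have "finite C" "C \<subset> insert (i + j) C" using that finite_subset by auto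
    then show ?thesis using assms(1) that(1) by (simp add: consistent_def)
  qed
  have "T ?A = map_pmf (restriction ?A) (T (insert (i + j) ?A))"
    using cons[of ?A] assms(2) by (simp add: lessThan_empty_iff)
  then have "measure_pmf.prob (T ?A) ?X =
      measure_pmf.prob (map_pmf (restriction ?A) (T (insert (i + j) ?A))) ?X"
    by (rule arg_cong)
  also have "\<dots> = p {#card ?A, 1#} * measure_pmf.prob (T ?A) ?X +
    (\<Sum>C\<in>blocks_with 0 ?A. (p {#card C + 1, card (?A - C)#} + p {#card C, card (?A - C) + 1#}) *
      measure_pmf.prob (joined ?A C) ?X)"
    using cons assms(2,3) by (intro prob_restriction_remove_point) auto
  also have "(\<Sum>C\<in>blocks_with 0 ?A. (p {#card C + 1, card (?A - C)#} + p {#card C, card (?A - C) + 1#}) *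
      measure_pmf.prob (joined ?A C) ?X) =
    (\<Sum>C\<in>blocks_with 0 ?A. if C = ?D then p {#i + 1, j#} + p {#i, j + 1#} else 0)"
    using prob_joined_children[OF _ _ D] cards by (intro sum.cong) auto
  also have "\<dots> = p {#i + 1, j#} + p {#i, j + 1#}"
    using D finite_blocks_with[of ?A 0] by simp
  also have "measure_pmf.prob (T ?A) ?X = p {#i, j#}"
    using prob_root_split[OF _ D] cards by simp
  finally show ?thesis by (simp add: card_lessThan right_diff_distrib mult.commute)
qed

text \<open>By the recursion, the mixture over root splits in \<open>prob_restriction_remove_point\<close> is the law of the tree
  on \<open>A\<close> scaled by \<open>1 - p(n, 1)\<close>, and the isolated point contributes the missing mass \<open>p(n, 1)\<close>.\<close>

lemma remove_point_consistent:
  assumes rec: "\<And>i j. 1 \<le> i \<Longrightarrow> 1 \<le> j \<Longrightarrow>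
      p {#i, j#} * (1 - p {#i + j, 1#}) = p {#i + 1, j#} + p {#i, j + 1#}"
    and "finite A" "A \<noteq> {}" "b \<notin> A"
  shows "map_pmf (restriction A) (T (insert b A)) = T A"
  using assms(2-)
proof (induction A rule: finite_psubset_induct)
  case (psubset A)
  obtain e where e: "e \<in> A" using psubset.prems by blast
  show ?case
  proof (cases "2 \<le> card A")
    case True
    have "measure_pmf.prob (map_pmf (restriction A) (T (insert b A))) X = measure_pmf.prob (T A) X" for X
    proof -
      have "measure_pmf.prob (map_pmf (restriction A) (T (insert b A))) X =
        p {#card A, 1#} * measure_pmf.prob (T A) X +
        (\<Sum>C\<in>blocks_with e A. (p {#card C + 1, card (A - C)#} + p {#card C, card (A - C) + 1#}) *
          measure_pmf.prob (joined A C) X)"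
        using psubset.IH psubset.prems
        by (intro prob_restriction_remove_point[OF psubset.hyps True e]) auto
      also have "(\<Sum>C\<in>blocks_with e A. (p {#card C + 1, card (A - C)#} + p {#card C, card (A - C) + 1#}) *
          measure_pmf.prob (joined A C) X) =
        (\<Sum>C\<in>blocks_with e A. (1 - p {#card A, 1#}) * (p {#card C, card (A - C)#} *
          measure_pmf.prob (joined A C) X))"
      proof (rule sum.cong[OF refl])
        fix C assume "C \<in> blocks_with e A"
        note C = blocks_withD[OF psubset.hyps this]
        have "1 \<le> card C" "1 \<le> card (A - C)" using C by (simp_all add: Suc_le_eq card_gt_0_iff)
        moreover have "card C + card (A - C) = card A"
          using card_Un_disjoint[OF C(1,4,8)] C(9) by simp
        ultimately show "(p {#card C + 1, card (A - C)#} + p {#card C, card (A - C) + 1#}) *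
          measure_pmf.prob (joined A C) X = (1 - p {#card A, 1#}) * (p {#card C, card (A - C)#} *
          measure_pmf.prob (joined A C) X)"
          using rec[of "card C" "card (A - C)", symmetric] by (simp add: ac_simps)
      qed
      also have "\<dots> = (1 - p {#card A, 1#}) * measure_pmf.prob (T A) X"
        using prob_T_mixture[OF psubset.hyps True e] by (simp add: sum_distrib_left)
      finally show ?thesis by (simp add: algebra_simps)
    qed
    from this[of "{_}"] show ?thesis by (intro pmf_eqI) (simp add: pmf.rep_eq)
  next
    case False
    then have "card A = 1" using psubset by (simp add: Suc_leI card_gt_0_iff not_less_eq_eq numeral_2_eq_2 le_antisym)
    then have "A = {e}" using e by (auto simp: card_1_singleton_iff)
    then show ?thesis using restriction_T_singleton psubset.hyps by simp
  qed
qed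

lemma remove_points_consistent:
  assumes rec: "\<And>i j. 1 \<le> i \<Longrightarrow> 1 \<le> j \<Longrightarrow>
      p {#i, j#} * (1 - p {#i + j, 1#}) = p {#i + 1, j#} + p {#i, j + 1#}"
    and D: "finite D" and A: "finite A" "A \<noteq> {}" "A \<inter> D = {}"
  shows "map_pmf (restriction A) (T (A \<union> D)) = T A"
  using D A(3)
proof (induction D rule: finite_induct)
  case empty
  show ?case using restriction_self_T[OF A(1,2)] by simp
next
  case (insert b D)
  have "map_pmf (restriction A) (T (A \<union> insert b D)) =
      map_pmf (restriction A) (map_pmf (restriction (A \<union> D)) (T (insert b (A \<union> D))))"
    by (simp add: map_pmf_comp restriction_restriction)
  also have "map_pmf (restriction (A \<union> D)) (T (insert b (A \<union> D))) = T (A \<union> D)"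
    by (rule remove_point_consistent[OF rec]) (use A insert.hyps insert.prems in auto)
  finally show ?case using insert.IH insert.prems by simp
qed

lemma recursion_consistent:
  assumes rec: "\<And>i j. 1 \<le> i \<Longrightarrow> 1 \<le> j \<Longrightarrow>
      p {#i, j#} * (1 - p {#i + j, 1#}) = p {#i + 1, j#} + p {#i, j + 1#}"
  shows "consistent T"
  unfolding consistent_def
proof (intro allI impI)
  fix A B :: "nat set" assume "finite B \<and> A \<noteq> {} \<and> A \<subset> B"
  then have A: "finite A" "finite (B - A)" "A \<noteq> {}" "A \<union> (B - A) = B" "A \<inter> (B - A) = {}"
    using finite_subset by auto
  show "map_pmf (restriction A) (T B) = T A"
    using remove_points_consistent[OF rec A(2,1,3,5)] A(4) by simp
qed

text \<open>The normalization leaves no freedom: a splitting rule that is proportional to the beta integrals for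
  each fixed number of points is the beta-splitting rule.\<close>

lemma proportional_beta:
  assumes "-2 < \<beta>"
    and proportional: "\<And>i j. 1 \<le> i \<Longrightarrow> 1 \<le> j \<Longrightarrow> p {#i, j#} = K (i + j) * beta_integral \<beta> i j"
  shows "has_beta_splitting_rule p \<beta>"
  unfolding has_beta_splitting_rule_def
proof (intro allI impI)
  fix i j :: nat assume ij: "1 \<le> i" "1 \<le> j"
  let ?n = "i + j"
  have "1 = (\<Sum>k = 1..?n - 1. real ((?n - 1) choose (k - 1)) * p {#k, ?n - k#})"
    using splitting_rule_sum[of ?n] ij by simp
  also have "\<dots> = (\<Sum>k = 1..?n - 1. K ?n * (real ((?n - 1) choose (k - 1)) * beta_integral \<beta> k (?n - k)))"
  proof (rule sum.cong[OF refl])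
    fix k assume "k \<in> {1..?n - 1}"
    then have "1 \<le> k" "1 \<le> ?n - k" using ij by auto
    then show "real ((?n - 1) choose (k - 1)) * p {#k, ?n - k#} =
        K ?n * (real ((?n - 1) choose (k - 1)) * beta_integral \<beta> k (?n - k))"
      using proportional[of k "?n - k"] by simp
  qed
  also have "\<dots> = K ?n * beta_normalization \<beta> ?n"
    by (simp add: beta_normalization_def sum_distrib_left)
  finally have "K ?n = 1 / beta_normalization \<beta> ?n"
    by (metis mult_zero_right nonzero_eq_divide_eq zero_neq_one)
  then show "p {#i, j#} = beta_splitting_rule \<beta> i j"
    using proportional[OF ij] by (simp add: beta_splitting_rule_def)
qed

lemma consistent_product_form_beta:
  assumes "consistent T" "product_form p"
  shows "\<exists>\<beta>>-2. has_beta_splitting_rule p \<beta>"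
proof -
  obtain w Z :: "nat \<Rightarrow> real" where w: "\<And>j. 1 \<le> j \<Longrightarrow> 0 \<le> w j" and Z: "\<And>n. 2 \<le> n \<Longrightarrow> Z n \<noteq> 0"
    and p: "\<And>i j. 1 \<le> i \<Longrightarrow> 1 \<le> j \<Longrightarrow> p {#i, j#} = w i * w j / Z (i + j)"
    using assms(2) unfolding product_form_def by blast
  note rec = consistent_recursion[OF assms(1)]
  have nz: "\<exists>k\<in>{1..n - 1}. p {#k, n - k#} \<noteq> 0" if "2 \<le> n" for n
  proof (rule ccontr)
    assume "\<not> ?thesis"
    then have "(\<Sum>k = 1..n - 1. real ((n - 1) choose (k - 1)) * p {#k, n - k#}) = 0"
      by (intro sum.neutral) auto
    then show False using splitting_rule_sum[OF that] by simp
  qed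
  have pos: "0 < w j" if "1 \<le> j" for j
    using weights_pos[of w Z "\<lambda>i j. p {#i, j#}" j, OF w Z p rec nz that] .
  obtain a d where "0 < a" "0 \<le> d" "\<And>i. w (i + 2) = w (i + 1) * (a + d * real i)"
    using weight_ratios_affine[of w Z "\<lambda>i j. p {#i, j#}", OF pos Z p rec] by blast
  then obtain \<beta> c where \<beta>: "-2 < \<beta>"
    and c: "\<And>i j. 1 \<le> i \<Longrightarrow> 1 \<le> j \<Longrightarrow> w i * w j = c (i + j) * beta_integral \<beta> i j"
    using weights_beta by metis
  have "has_beta_splitting_rule p \<beta>"
    by (rule proportional_beta[OF \<beta>, where K = "\<lambda>n. c n / Z n"]) (simp add: p c)
  then show ?thesis using \<beta> by blast
qed

lemma beta_consistent:
  assumes "-2 < \<beta>" "has_beta_splitting_rule p \<beta>"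
  shows "consistent T"
proof (rule recursion_consistent)
  fix i j :: nat assume "1 \<le> i" "1 \<le> j"
  then show "p {#i, j#} * (1 - p {#i + j, 1#}) = p {#i + 1, j#} + p {#i, j + 1#}"
    using beta_splitting_rule_recursion[OF assms(1), of i j] assms(2)
    by (simp add: has_beta_splitting_rule_def)
qed

end

lemma beta_product_form:
  assumes "-2 < \<beta>" "has_beta_splitting_rule p \<beta>"
  shows "product_form p"
proof -
  obtain w c where w: "\<And>j::nat. 1 \<le> j \<Longrightarrow> 0 < w j" and c: "\<And>n::nat. 2 \<le> n \<Longrightarrow> (0::real) < c n"
    and I: "\<And>i j. 1 \<le> i \<Longrightarrow> 1 \<le> j \<Longrightarrow> beta_integral \<beta> i j = w i * w j / c (i + j)"
    using beta_integral_product[OF assms(1)] by metis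
  show ?thesis
    unfolding product_form_def
  proof (rule exI[of _ w], rule exI[of _ "\<lambda>n. c n * beta_normalization \<beta> n"], intro conjI allI impI)
    show "0 \<le> w j" if "1 \<le> j" for j using w[OF that] by simp
    show "c n * beta_normalization \<beta> n \<noteq> 0" if "2 \<le> n" for n
      using c[OF that] beta_normalization_pos[OF assms(1) that] by simp
    show "p {#i, j#} = w i * w j / (c (i + j) * beta_normalization \<beta> (i + j))" if "1 \<le> i" "1 \<le> j" for i j
      using assms(2) I[OF that] that by (simp add: has_beta_splitting_rule_def beta_splitting_rule_def)
  qed
qed

theorem theorem2:
  fixes T :: model and p :: "nat multiset \<Rightarrow> real"
  assumes "random_fragmentation_model T" and "exchangeable T p"
    and "markovian T" and "binary_model T"
  shows "(consistent T \<longrightarrow> (product_form p \<longleftrightarrow> (\<exists>\<beta>>-2. has_beta_splitting_rule p \<beta>))) \<and>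
         (\<forall>\<beta>>-2. has_beta_splitting_rule p \<beta> \<longrightarrow> consistent T)"
proof -
  interpret markov_binary_model T p
    using assms by unfold_locales (simp_all add: exchangeable_def)
  show ?thesis using consistent_product_form_beta beta_product_form beta_consistent by blast
qed

end
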